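(* Let $V$ be a vector space over the finite field $\mathbb{F}_q$ with basis $\{b_1,\dots,b_n\}$, and let $\mathcal{X}=(X_1,\dots,X_k)$ be a family of subspaces of $V$ such that each $X_i=\langle b_j : j\in L_i\rangle$ for some set $L_i\subseteq\{1,\dots,n\}$. Then the $q$-transversal matroid associated with $\mathcal{X}$ (the $q$-matroid whose independent subspaces are the partial $q$-transversals of $\mathcal{X}$) is representable.
   Context: A partial $q$-transversal of $\mathcal{X}$ is a subspace $T\le V$ such that every vector basis $B$ of $T$ admits an injection $\pi:B\to\{1,\dots,k\}$ with $b\notin X_{\pi(b)}$ for all $b\in B$; these form the independent subspaces of a $q$-matroid on $V$ (rank function $r$ with $0\le r(A)\le\dim A$, monotone, submodular; independent means $r(A)=\dim A$). Identify $V$ with $\mathbb{F}_q^n$ via the basis $b_1,\dots,b_n$. A $q$-matroid on $\mathbb{F}_q^n$ is representable if there is a field $K\supseteq\mathbb{F}_q$ and a matrix $G$ over $K$ with $n$ columns such that for every subspace $U$, if $U$ is the row space of a matrix $X$ over $\mathbb{F}_q$, then the rank of $U$ in the $q$-matroid equals the rank of the matrix $GX^T$. *)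

theory Defs
  imports "HOL-Algebra.Algebraic_Closure_Type"
begin

text \<open>
  Matrices are functions \<open>nat \<Rightarrow> nat \<Rightarrow> _\<close> with indices starting at 1; the dimensions are separate
  arguments and entries outside the range are irrelevant.
\<close>

definition columns_independent ::
    "('c, 'd) ring_scheme \<Rightarrow> nat \<Rightarrow> (nat \<Rightarrow> nat \<Rightarrow> 'c) \<Rightarrow> nat set \<Rightarrow> bool" where
  "columns_independent K l M J \<longleftrightarrow>
     (\<forall>c \<in> J \<rightarrow> carrier K.
        (\<forall>i\<in>{1..l}. (\<Oplus>\<^bsub>K\<^esub> j\<in>J. M i j \<otimes>\<^bsub>K\<^esub> c j) = \<zero>\<^bsub>K\<^esub>) \<longrightarrow> (\<forall>j\<in>J. c j = \<zero>\<^bsub>K\<^esub>))"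

definition matrix_rank ::
    "('c, 'd) ring_scheme \<Rightarrow> nat \<Rightarrow> nat \<Rightarrow> (nat \<Rightarrow> nat \<Rightarrow> 'c) \<Rightarrow> nat" where
  "matrix_rank K l m M = Max {card J | J. J \<subseteq> {1..m} \<and> columns_independent K l M J}"

locale finite_field_vector_space = vector_space scale
  for scale :: "'a::{field,finite} \<Rightarrow> 'b::ab_group_add \<Rightarrow> 'b" (infixr "*s" 75)
begin

definition vector_basis :: "'b set \<Rightarrow> 'b set \<Rightarrow> bool" where
  "vector_basis B T \<longleftrightarrow> B \<subseteq> T \<and> independent B \<and> span B = T"

definition q_matroid :: "('b set \<Rightarrow> nat) \<Rightarrow> bool" where
  "q_matroid r \<longleftrightarrow>
     (\<forall>A. subspace A \<longrightarrow> r A \<le> dim A) \<and>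
     (\<forall>A B. subspace A \<longrightarrow> subspace B \<longrightarrow> A \<subseteq> B \<longrightarrow> r A \<le> r B) \<and>
     (\<forall>A B. subspace A \<longrightarrow> subspace B \<longrightarrow> r (span (A \<union> B)) + r (A \<inter> B) \<le> r A + r B)"

definition q_independent :: "('b set \<Rightarrow> nat) \<Rightarrow> 'b set \<Rightarrow> bool" where
  "q_independent r A \<longleftrightarrow> subspace A \<and> r A = dim A"

definition partial_q_transversal :: "nat \<Rightarrow> (nat \<Rightarrow> 'b set) \<Rightarrow> 'b set \<Rightarrow> bool" where
  "partial_q_transversal k Xs T \<longleftrightarrow>
     subspace T \<and>
     (\<forall>B. vector_basis B T \<longrightarrow>
        (\<exists>\<pi>. inj_on \<pi> B \<and> \<pi> ` B \<subseteq> {1..k} \<and> (\<forall>b\<in>B. b \<notin> Xs (\<pi> b))))"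

text \<open>
  The values of \<open>r\<close> on subspaces are determined by the independent subspaces, so this predicate
  identifies the \<open>q\<close>-transversal matroid uniquely; values of \<open>r\<close> on other sets play no role.
\<close>

definition is_q_transversal_matroid ::
    "nat \<Rightarrow> (nat \<Rightarrow> 'b set) \<Rightarrow> ('b set \<Rightarrow> nat) \<Rightarrow> bool" where
  "is_q_transversal_matroid k Xs r \<longleftrightarrow>
     q_matroid r \<and> (\<forall>T. q_independent r T \<longleftrightarrow> partial_q_transversal k Xs T)"

text \<open>
  The row space of an \<open>m \<times> n\<close> matrix over the scalars, where the coordinate vector
  \<open>(c\<^sub>1, \<dots>, c\<^sub>n)\<close> is identified with \<open>c\<^sub>1 b\<^sub>1 + \<dots> + c\<^sub>n b\<^sub>n\<close>.
\<close>

definition row_space ::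
    "nat \<Rightarrow> (nat \<Rightarrow> 'b) \<Rightarrow> nat \<Rightarrow> (nat \<Rightarrow> nat \<Rightarrow> 'a) \<Rightarrow> 'b set" where
  "row_space n b m Y = span ((\<lambda>i. \<Sum>j\<in>{1..n}. Y i j *s b j) ` {1..m})"

text \<open>
  \<open>G Y\<^sup>T\<close> is formed after embedding the scalars into \<open>K\<close> by \<open>h\<close>, which is injective
  because it is a unital homomorphism of fields.

  HOL cannot quantify over the type of the elements of \<open>K\<close>. As the scalar field is finite,
  letting the elements be natural numbers is no restriction: \<open>G\<close> has finitely many entries,
  so \<open>K\<close> can be replaced by the subfield generated by these entries and the image of \<open>h\<close>. That
  subfield is countable, hence isomorphic to a field whose carrier is a set of natural numbers,
  and ranks do not change.
\<close>

definition q_representable :: "nat \<Rightarrow> (nat \<Rightarrow> 'b) \<Rightarrow> ('b set \<Rightarrow> nat) \<Rightarrow> bool" where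
  "q_representable n b r \<longleftrightarrow>
     (\<exists>(K :: nat ring) h l G.
        field K \<and>
        h \<in> ring_hom (ring_of_type_algebra :: 'a ring) K \<and>
        (\<forall>s\<in>{1..l}. \<forall>j\<in>{1..n}. G s j \<in> carrier K) \<and>
        (\<forall>U m Y. subspace U \<longrightarrow> U = row_space n b m Y \<longrightarrow>
           r U = matrix_rank K l m (\<lambda>s i. \<Oplus>\<^bsub>K\<^esub> j\<in>{1..n}. G s j \<otimes>\<^bsub>K\<^esub> h (Y i j))))"

end

end

theory Submission
  imports Defs "HOL-Library.Function_Algebras" "HOL-Library.Countable_Set"
begin

text \<open>
  Write \<open>F\<close> for the scalar field and \<open>S\<^sub>i\<close> for the complement of \<open>L\<^sub>i\<close>, so that \<open>v \<notin> X\<^sub>i\<close> iff \<open>v\<close>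
  has a nonzero coordinate in \<open>S\<^sub>i\<close>. Over the infinite field \<open>K = F(t)\<close> we choose a \<open>k \<times> n\<close> matrix
  \<open>G\<close> whose row \<open>i\<close> is supported on \<open>S\<^sub>i\<close> and otherwise generic; then \<open>T\<close> is a partial
  \<open>q\<close>-transversal iff \<open>G\<close> is injective on \<open>T \<otimes> K\<close>.

  If \<open>G\<close> is injective on \<open>T \<otimes> K\<close> and \<open>B\<close> is a basis of \<open>T\<close>, the independent vectors \<open>G x\<close> for \<open>x \<in> B\<close>
  admit an injection \<open>\<pi>\<close> such that coordinate \<open>\<pi> x\<close> of \<open>G x\<close> is nonzero; as row \<open>\<pi> x\<close> of \<open>G\<close>
  vanishes on the corresponding subspace of the family, \<open>x\<close> does not lie in it. Conversely, for a partial
  transversal \<open>T\<close> and a set \<open>I\<close> of rows, a basis of \<open>T\<close> extending one of \<open>T \<inter> (\<Inter>i\<in>I. X\<^sub>i)\<close>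
  shows that this intersection has dimension at most \<open>k - |I|\<close>, and the bound survives the
  extension of scalars. The rows are then chosen one at a time. Let \<open>N\<close> be the common kernel in
  \<open>T \<otimes> K\<close> of the rows already chosen, and suppose that \<open>N \<inter> (\<Inter>i\<in>I. X\<^sub>i)\<close> has dimension at most
  \<open>m - |I|\<close> for every subset \<open>I\<close> of the \<open>m\<close> remaining rows. A further row \<open>p\<close> preserves this: either
  the intersection is contained in \<open>X\<^sub>p\<close>, and the bound for \<open>I \<union> {p}\<close> applies, or it contains a vector
  with a nonzero coordinate in \<open>S\<^sub>p\<close>, on which the generic row does not vanish, so the dimension
  drops. When no rows remain the kernel is zero. Only finitely many \<open>T\<close> and \<open>I\<close> occur, so one
  choice of each row serves all of them.
\<close>

declare One_nat_def [simp del]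

section \<open>Dimension of finitely spanned sets\<close>

context vector_space
begin

text \<open>The function spaces used later are infinite-dimensional, and \<open>dim\<close> is a
  cardinality with value 0 when bases are infinite. The finite spanning set \<open>C\<close>
  excludes that case.\<close>

lemma finite_basis_exists:
  assumes "finite C" "S \<subseteq> span C"
  obtains B where "B \<subseteq> S" "independent B" "finite B" "S \<subseteq> span B" "card B = dim S"
proof -
  obtain B where B: "B \<subseteq> S" "independent B" "S \<subseteq> span B" "card B = dim S"
    using basis_exists by blast
  moreover have "finite B"
    using independent_span_bound[OF assms(1) B(2)] B(1) assms(2) by blast
  ultimately show thesis
    using that by blast
qed

lemma card_independent_le_dim:
  assumes "finite C" "S \<subseteq> span C" "independent B" "B \<subseteq> S"
  shows "finite B \<and> card B \<le> dim S"
proof -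
  obtain A where "A \<subseteq> S" "finite A" "S \<subseteq> span A" "card A = dim S"
    using finite_basis_exists[OF assms(1,2)] by metis
  then show ?thesis
    using independent_span_bound[of A B] assms(3,4) by auto
qed

lemma dim_mono_finite:
  assumes "finite C" "N \<subseteq> span C" "A \<subseteq> N"
  shows "dim A \<le> dim N"
proof -
  obtain B where B: "B \<subseteq> A" "independent B" "A \<subseteq> span B" "card B = dim A"
    using basis_exists[of A] by blast
  then have "card B \<le> dim N"
    using card_independent_le_dim[OF assms(1,2), of B] assms(3) by blast
  then show ?thesis
    using B by simp
qed

lemma dim_strict_mono_finite:
  assumes "finite C" "N \<subseteq> span C" "A \<subseteq> N" "subspace A" "x \<in> N" "x \<notin> A"
  shows "dim A < dim N"
proof -
  obtain B where B: "B \<subseteq> A" "independent B" "finite B" "A \<subseteq> span B" "card B = dim A"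
    using finite_basis_exists[of C A] assms(1-3) by blast
  have "span B \<subseteq> A"
    using B(1) assms(4) by (rule span_minimal)
  then have "x \<notin> span B"
    using assms(6) by blast
  then have "independent (insert x B)" "x \<notin> B"
    using B independent_insertI span_base by blast+
  moreover have "insert x B \<subseteq> N"
    using B assms by auto
  ultimately show ?thesis
    using card_independent_le_dim[OF assms(1,2), of "insert x B"] B(3,5) by simp
qed

text \<open>A basis \<open>I\<close> of the intersection is extended to bases \<open>D\<close> of
  \<open>A\<close> and \<open>E\<close> of \<open>B\<close>; then \<open>D \<union> E\<close> spans
  \<open>A \<union> B\<close>, and \<open>D \<inter> E\<close> contains \<open>I\<close>.\<close>

lemma dim_submodular:
  assumes "finite C" "A \<subseteq> span C" "B \<subseteq> span C"
  shows "dim (span (A \<union> B)) + dim (A \<inter> B) \<le> dim A + dim B"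
proof -
  have "A \<inter> B \<subseteq> span C"
    using assms(2) by blast
  then obtain I where I: "I \<subseteq> A \<inter> B" "independent I" "finite I" "card I = dim (A \<inter> B)"
    using finite_basis_exists[OF assms(1)] by metis
  obtain D where D: "I \<subseteq> D" "D \<subseteq> A" "independent D" "A \<subseteq> span D"
    using maximal_independent_subset_extend[OF _ I(2), of A] I(1) by (metis le_infE)
  obtain E where E: "I \<subseteq> E" "E \<subseteq> B" "independent E" "B \<subseteq> span E"
    using maximal_independent_subset_extend[OF _ I(2), of B] I(1) by (metis le_infE)
  have fin: "finite D" "finite E"
    using card_independent_le_dim[OF assms(1,2) D(3,2)]
      card_independent_le_dim[OF assms(1,3) E(3,2)] by simp_all
  have cards: "card D = dim A" "card E = dim B"
    using basis_card_eq_dim[OF D(2,4,3)] basis_card_eq_dim[OF E(2,4,3)] .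
  have "A \<union> B \<subseteq> span (D \<union> E)"
    using order_trans[OF D(4) span_mono[of D "D \<union> E"]] order_trans[OF E(4) span_mono[of E "D \<union> E"]]
    by simp
  then have "dim (span (A \<union> B)) \<le> card (D \<union> E)"
    using fin by (intro dim_le_card span_minimal) simp_all
  moreover have "card (D \<union> E) + card I \<le> card D + card E"
    using card_Un_Int[OF fin] card_mono[of "D \<inter> E" I] fin D(1) E(1) by auto
  ultimately show ?thesis
    using I(4) cards by simp
qed

text \<open>Matches the maximum in \<open>matrix_rank\<close>, which ranges over sets of column
  indices rather than sets of vectors; \<open>inj_on\<close> makes repeated columns count as
  dependent.\<close>

lemma dim_image_eq_Max_card:
  assumes "finite J"
  shows "dim (w ` J) = Max {card I | I. I \<subseteq> J \<and> inj_on w I \<and> independent (w ` I)}"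
    (is "_ = Max ?A")
proof (rule sym, rule Max_eqI)
  show "finite ?A"
    using assms by (auto intro: finite_subset[of _ "card ` Pow J"])
next
  fix y assume "y \<in> ?A"
  then obtain I where I: "y = card I" "I \<subseteq> J" "inj_on w I" "independent (w ` I)"
    by blast
  have "card (w ` I) \<le> dim (w ` J)"
    using card_independent_le_dim[of "w ` J" "w ` J" "w ` I"] assms I span_superset
    by (simp add: image_mono)
  then show "y \<le> dim (w ` J)"
    using I by (simp add: card_image)
next
  obtain B where B: "B \<subseteq> w ` J" "independent B" "card B = dim (w ` J)"
    using basis_exists by blast
  obtain I where "I \<subseteq> J" "inj_on w I" "B = w ` I"
    using B(1)[unfolded subset_image_inj] by blast
  with B show "dim (w ` J) \<in> ?A"
    by (auto simp: card_image intro!: exI[of _ I])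
qed

end

section \<open>Generic rows over an infinite field\<close>

definition vscale :: "'k::field \<Rightarrow> (nat \<Rightarrow> 'k) \<Rightarrow> nat \<Rightarrow> 'k" where
  "vscale c v = (\<lambda>j. c * v j)"

global_interpretation kvec: vector_space vscale
  by unfold_locales (auto simp: vscale_def fun_eq_iff algebra_simps)

lemma sum_fun_apply: "(\<Sum>x\<in>A. f x) j = (\<Sum>x\<in>A. f x j)"
  for f :: "'i \<Rightarrow> nat \<Rightarrow> 'k::comm_monoid_add"
  by (induction A rule: infinite_finite_induct) auto

text \<open>Induction on \<open>S\<close>: each vector with \<open>v s \<noteq> 0\<close> rules out
  one value of the new coefficient, and the others are settled by the induction hypothesis.\<close>

lemma exists_avoiding_hyperplanes:
  fixes A :: "(nat \<Rightarrow> 'k::field) set"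
  assumes "infinite (UNIV :: 'k set)" "finite S" "finite A" "\<And>v. v \<in> A \<Longrightarrow> \<exists>j\<in>S. v j \<noteq> 0"
  shows "\<exists>x. \<forall>v\<in>A. (\<Sum>j\<in>S. x j * v j) \<noteq> 0"
  using assms(2-4)
proof (induction S arbitrary: A rule: finite_induct)
  case empty
  then show ?case by blast
next
  case (insert s S)
  have "\<exists>x. \<forall>v\<in>{v \<in> A. \<exists>j\<in>S. v j \<noteq> 0}. (\<Sum>j\<in>S. x j * v j) \<noteq> 0"
    using insert.prems(1) by (intro insert.IH) simp_all
  then obtain x where x: "\<And>v. v \<in> A \<Longrightarrow> \<exists>j\<in>S. v j \<noteq> 0 \<Longrightarrow> (\<Sum>j\<in>S. x j * v j) \<noteq> 0"
    by blast
  \<comment> \<open>For \<open>v s = 0\<close> the quotient is 0 by convention, so such vectors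
    exclude at most the value 0.\<close>
  have "finite ((\<lambda>v. - (\<Sum>j\<in>S. x j * v j) / v s) ` A)"
    using insert.prems by simp
  then obtain t where "t \<notin> (\<lambda>v. - (\<Sum>j\<in>S. x j * v j) / v s) ` A"
    using ex_new_if_finite[OF assms(1)] by blast
  then have t: "t \<noteq> - (\<Sum>j\<in>S. x j * v j) / v s" if "v \<in> A" for v
    using that by blast
  have "(\<Sum>j\<in>insert s S. (x(s := t)) j * v j) \<noteq> 0" if v: "v \<in> A" for v
  proof -
    have "(\<Sum>j\<in>S. (x(s := t)) j * v j) = (\<Sum>j\<in>S. x j * v j)"
      using insert.hyps by (intro sum.cong) auto
    then have *: "(\<Sum>j\<in>insert s S. (x(s := t)) j * v j) = t * v s + (\<Sum>j\<in>S. x j * v j)"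
      using insert.hyps by simp
    show ?thesis
    proof (cases "v s = 0")
      case True
      then show ?thesis
        using x[OF v] insert.prems(2)[OF v] * by auto
    next
      case False
      then show ?thesis
        using t[OF v] * by (simp add: field_simps eq_neg_iff_add_eq_0)
    qed
  qed
  then show ?case by blast
qed

text \<open>The bounds are a Hall-type condition. Row \<open>Suc k\<close> is chosen first and each
  \<open>N\<close> is cut down to its kernel; the induction runs over whole families
  \<open>\<N>\<close>, so that one row serves all members.\<close>

lemma generic_rows_trivial_kernel:
  fixes \<N> :: "(nat \<Rightarrow> 'k::field) set set"
  assumes "infinite (UNIV :: 'k set)" "\<And>p. finite (S p)" "finite \<N>"
    and "\<And>N. N \<in> \<N> \<Longrightarrow> kvec.subspace N"
    and "\<And>N. N \<in> \<N> \<Longrightarrow> \<exists>C. finite C \<and> N \<subseteq> kvec.span C"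
    and "\<And>N I. N \<in> \<N> \<Longrightarrow> I \<subseteq> {1..k} \<Longrightarrow>
           kvec.dim {v \<in> N. \<forall>p\<in>I. \<forall>j\<in>S p. v j = 0} \<le> k - card I"
  shows "\<exists>x. \<forall>N\<in>\<N>. \<forall>v\<in>N. (\<forall>p\<in>{1..k}. (\<Sum>j\<in>S p. x p j * v j) = 0) \<longrightarrow> v = 0"
  using assms(3-6)
proof (induction k arbitrary: \<N>)
  case 0
  \<comment> \<open>With no rows left, the bound for \<open>I = {}\<close> says that
    \<open>N\<close> has dimension 0.\<close>
  have "v = 0" if N: "N \<in> \<N>" and v: "v \<in> N" for N v
  proof (rule ccontr)
    assume "v \<noteq> 0"
    moreover obtain C where "finite C" "N \<subseteq> kvec.span C"
      using 0 N by blast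
    ultimately have "card {v} \<le> kvec.dim N"
      using kvec.card_independent_le_dim[of C N "{v}"] v by simp
    then show False
      using "0.prems"(4)[OF N, of "{}"] by simp
  qed
  then show ?case by blast
next
  case (Suc k)
  define Z where "Z I = {v :: nat \<Rightarrow> 'k. \<forall>p\<in>I. \<forall>j\<in>S p. v j = 0}" for I
  have Z_sub: "kvec.subspace (N \<inter> Z I)" if "N \<in> \<N>" for N I
    using Suc.prems(2)[OF that]
    unfolding kvec.subspace_def Z_def by (auto simp: vscale_def)
  have dim_Z: "kvec.dim (N \<inter> Z I) \<le> Suc k - card I" if "N \<in> \<N>" "I \<subseteq> {1..Suc k}" for N I
  proof -
    have "N \<inter> Z I = {v \<in> N. \<forall>p\<in>I. \<forall>j\<in>S p. v j = 0}"
      by (auto simp: Z_def)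
    then show ?thesis
      using Suc.prems(4)[OF that] by simp
  qed
  \<comment> \<open>One test vector for each pair \<open>(N, I)\<close>. If no suitable vector
    exists, the chosen value is arbitrary, and \<open>A\<close> drops it if it vanishes on
    \<open>S (Suc k)\<close>.\<close>
  define w where "w N I = (SOME v. v \<in> N \<inter> Z I \<and> (\<exists>j\<in>S (Suc k). v j \<noteq> 0))" for N I
  define A where "A = {v. (\<exists>j\<in>S (Suc k). v j \<noteq> 0)} \<inter> (\<lambda>(N, I). w N I) ` (\<N> \<times> Pow {1..k})"
  have "finite A"
    unfolding A_def using Suc.prems(1) by auto
  then have "\<exists>x. \<forall>v\<in>A. (\<Sum>j\<in>S (Suc k). x j * v j) \<noteq> 0"
    using assms(1,2) by (intro exists_avoiding_hyperplanes) (simp_all add: A_def)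
  then obtain x where x: "\<And>v. v \<in> A \<Longrightarrow> (\<Sum>j\<in>S (Suc k). x j * v j) \<noteq> 0"
    by blast
  define g where "g v = (\<Sum>j\<in>S (Suc k). x j * v j)" for v
  have g_add: "g (u + v) = g u + g v" for u v
    by (simp add: g_def algebra_simps sum.distrib)
  have g_scale: "g (vscale c v) = c * g v" for c v
    by (simp add: g_def vscale_def sum_distrib_left algebra_simps)
  define cut where "cut N = {v \<in> N. g v = 0}" for N
  have cut_sub: "kvec.subspace (cut N \<inter> Z I)" if "N \<in> \<N>" for N I
  proof -
    have "cut N \<inter> Z I = (N \<inter> Z I) \<inter> {v. g v = 0}"
      by (auto simp: cut_def)
    moreover have "kvec.subspace {v. g v = 0}"
      by (auto simp: kvec.subspace_def g_add g_scale) (simp add: g_def)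
    ultimately show ?thesis
      using Z_sub[OF that] by (metis kvec.subspace_inter)
  qed
  have "\<exists>y. \<forall>N\<in>cut ` \<N>. \<forall>v\<in>N. (\<forall>p\<in>{1..k}. (\<Sum>j\<in>S p. y p j * v j) = 0) \<longrightarrow> v = 0"
  proof (rule Suc.IH)
    show "finite (cut ` \<N>)"
      using Suc.prems(1) by simp
    show "kvec.subspace N" if "N \<in> cut ` \<N>" for N
      using that cut_sub[of _ "{}"] by (auto simp: Z_def)
    show "\<exists>C. finite C \<and> N \<subseteq> kvec.span C" if "N \<in> cut ` \<N>" for N
      using that Suc.prems(3) by (fastforce simp: cut_def)
    show "kvec.dim {v \<in> N'. \<forall>p\<in>I. \<forall>j\<in>S p. v j = 0} \<le> k - card I"
      if N': "N' \<in> cut ` \<N>" and I: "I \<subseteq> {1..k}" for N' I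
    proof -
      obtain N where N: "N \<in> \<N>" "N' = cut N"
        using N' by blast
      obtain C where C: "finite C" "N \<subseteq> kvec.span C"
        using Suc.prems(3) N by blast
      have eq: "{v \<in> N'. \<forall>p\<in>I. \<forall>j\<in>S p. v j = 0} = cut N \<inter> Z I"
        using N by (auto simp: Z_def)
      \<comment> \<open>Keeps the truncated subtraction exact: \<open>Suc k - card I\<close> exceeds
        \<open>k - card I\<close> by one.\<close>
      have card_I: "card I \<le> k"
        using card_mono[OF _ I] by simp
      show ?thesis
      proof (cases "\<exists>v \<in> N \<inter> Z I. \<exists>j\<in>S (Suc k). v j \<noteq> 0")
        case True
        then have "\<exists>v. v \<in> N \<inter> Z I \<and> (\<exists>j\<in>S (Suc k). v j \<noteq> 0)"
          by blast
        from someI_ex[OF this]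
        have w: "w N I \<in> N \<inter> Z I" "\<exists>j\<in>S (Suc k). w N I j \<noteq> 0"
          unfolding w_def by blast+
        have "w N I \<in> (\<lambda>(N, I). w N I) ` (\<N> \<times> Pow {1..k})"
          using N I by (intro image_eqI[of _ _ "(N, I)"]) simp_all
        then have "g (w N I) \<noteq> 0"
          using w(2) x by (simp add: A_def g_def)
        then have "w N I \<notin> cut N \<inter> Z I"
          by (simp add: cut_def)
        note w = w(1) this
        then have "kvec.dim (cut N \<inter> Z I) < kvec.dim (N \<inter> Z I)"
          using C cut_sub[OF N(1)] w
          by (intro kvec.dim_strict_mono_finite[of C]) (auto simp: cut_def)
        then show ?thesis
          using dim_Z[OF N(1), of I] I card_I unfolding eq by fastforce
      next
        case False
        then have "cut N \<inter> Z I \<subseteq> N \<inter> Z (insert (Suc k) I)"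
          by (auto simp: Z_def cut_def)
        then have "kvec.dim (cut N \<inter> Z I) \<le> kvec.dim (N \<inter> Z (insert (Suc k) I))"
          using C by (intro kvec.dim_mono_finite[of C]) auto
        moreover have "card (insert (Suc k) I) = Suc (card I)"
          using I finite_subset[OF I] by (subst card_insert_disjoint) auto
        ultimately show ?thesis
          using dim_Z[OF N(1), of "insert (Suc k) I"] I unfolding eq by fastforce
      qed
    qed
  qed
  then obtain y where y: "\<And>N v. N \<in> \<N> \<Longrightarrow> v \<in> cut N \<Longrightarrow>
      (\<forall>p\<in>{1..k}. (\<Sum>j\<in>S p. y p j * v j) = 0) \<Longrightarrow> v = 0"
    by blast
  have "v = 0" if N: "N \<in> \<N>" "v \<in> N"
    and v: "\<forall>p\<in>{1..Suc k}. (\<Sum>j\<in>S p. (y(Suc k := x)) p j * v j) = 0" for N v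
  proof (rule y[OF N(1)])
    show "v \<in> cut N"
      using v[rule_format, of "Suc k"] N by (simp add: cut_def g_def)
    show "\<forall>p\<in>{1..k}. (\<Sum>j\<in>S p. y p j * v j) = 0"
    proof
      fix p assume "p \<in> {1..k}"
      then show "(\<Sum>j\<in>S p. y p j * v j) = 0"
        using v[rule_format, of p] by simp
    qed
  qed
  then show ?case by blast
qed

section \<open>Independent families and matchings to nonzero coordinates\<close>

definition independent_family :: "nat set \<Rightarrow> ('i \<Rightarrow> nat \<Rightarrow> 'k::field) \<Rightarrow> 'i set \<Rightarrow> bool" where
  "independent_family P w J \<longleftrightarrow>
     (\<forall>c. (\<forall>p\<in>P. (\<Sum>j\<in>J. c j * w j p) = 0) \<longrightarrow> (\<forall>j\<in>J. c j = 0))"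

text \<open>Passing to the image set forgets repetitions, whence \<open>inj_on\<close>; since the
  vectors vanish outside \<open>P\<close>, relations tested on \<open>P\<close> are relations
  between functions.\<close>

lemma independent_family_iff_independent:
  assumes "finite J" "\<And>j p. j \<in> J \<Longrightarrow> p \<notin> P \<Longrightarrow> w j p = 0"
  shows "independent_family P w J \<longleftrightarrow> inj_on w J \<and> kvec.independent (w ` J)"
proof
  assume L: "independent_family P w J"
  have inj: "inj_on w J"
  proof (rule inj_onI, rule ccontr)
    fix i j assume ij: "i \<in> J" "j \<in> J" "w i = w j" "i \<noteq> j"
    let ?c = "\<lambda>l. if l = i then 1 else if l = j then -1 else (0 :: 'b)"
    have "(\<Sum>l\<in>J. ?c l * w l p) = 0" for p
    proof -
      have "(\<Sum>l\<in>J. ?c l * w l p) = (\<Sum>l\<in>{i, j}. ?c l * w l p)"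
        using ij assms(1) by (intro sum.mono_neutral_right) auto
      then show ?thesis
        using ij by simp
    qed
    then have "?c i = 0"
      using L[unfolded independent_family_def, rule_format, of ?c i] ij(1) by blast
    then show False by simp
  qed
  moreover have "kvec.independent (w ` J)"
    unfolding kvec.independent_explicit_module
  proof (intro allI impI)
    fix t u v
    assume t: "finite t" "t \<subseteq> w ` J" "(\<Sum>v\<in>t. vscale (u v) v) = 0" "v \<in> t"
    let ?c = "\<lambda>j. if w j \<in> t then u (w j) else 0"
    have "(\<Sum>j\<in>J. ?c j * w j p) = 0" for p
    proof -
      have "(\<Sum>j\<in>J. ?c j * w j p) = (\<Sum>v\<in>w ` J. (if v \<in> t then u v else 0) * v p)"
        using inj by (simp add: sum.reindex)
      also have "\<dots> = (\<Sum>v\<in>t. u v * v p)"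
        using t assms(1) by (intro sum.mono_neutral_cong_right) auto
      also have "\<dots> = (\<Sum>v\<in>t. vscale (u v) v) p"
        by (simp add: sum_fun_apply vscale_def)
      finally show ?thesis
        using t by simp
    qed
    then have "\<forall>j\<in>J. ?c j = 0"
      using L[unfolded independent_family_def, THEN spec, of ?c] by blast
    then show "u v = 0"
      using t by fastforce
  qed
  ultimately show "inj_on w J \<and> kvec.independent (w ` J)" ..
next
  assume R: "inj_on w J \<and> kvec.independent (w ` J)"
  show "independent_family P w J"
    unfolding independent_family_def
  proof (intro allI impI ballI)
    fix c j assume c: "\<forall>p\<in>P. (\<Sum>j\<in>J. c j * w j p) = 0" and j: "j \<in> J"
    let ?u = "\<lambda>v. c (the_inv_into J w v)"
    have "(\<Sum>v\<in>w ` J. vscale (?u v) v) = (\<Sum>j\<in>J. vscale (c j) (w j))"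
      using R by (simp add: sum.reindex the_inv_into_f_f)
    also have "\<dots> = 0"
    proof
      fix p
      have "(\<Sum>j\<in>J. c j * w j p) = 0"
        using c assms(2) by (cases "p \<in> P") simp_all
      then show "(\<Sum>j\<in>J. vscale (c j) (w j)) p = 0 p"
        by (simp add: sum_fun_apply vscale_def)
    qed
    finally have "?u (w j) = 0"
      using R[THEN conjunct2, unfolded kvec.independent_explicit_module, rule_format,
          of "w ` J" ?u "w j"] j assms(1) by simp
    then show "c j = 0"
      using R j by (simp add: the_inv_into_f_f)
  qed
qed

lemma independent_family_subset:
  assumes "independent_family P w J" "I \<subseteq> J" "finite J"
  shows "independent_family P w I"
  unfolding independent_family_def
proof (intro allI impI ballI)
  fix c i assume c: "\<forall>p\<in>P. (\<Sum>j\<in>I. c j * w j p) = 0" and i: "i \<in> I"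
  let ?c = "\<lambda>j. if j \<in> I then c j else 0"
  have "(\<Sum>j\<in>J. ?c j * w j p) = (\<Sum>j\<in>I. c j * w j p)" for p
    using assms by (intro sum.mono_neutral_cong_right) auto
  then have "\<forall>j\<in>J. ?c j = 0"
    using assms(1)[unfolded independent_family_def, THEN spec, of ?c] c by simp
  then show "c i = 0"
    using i assms by force
qed

text \<open>If no admissible coordinate \<open>p\<close> could be deleted, then every unit vector \<open>e\<^sub>p\<close> with
  \<open>w b p \<noteq> 0\<close> would lie in the span of the family over \<open>J\<close>, and hence so would \<open>w b\<close>.\<close>

lemma independent_family_delete_coordinate:
  assumes "independent_family P w (insert b J)" "finite P" "finite J" "b \<notin> J"
  shows "\<exists>p\<in>P. w b p \<noteq> 0 \<and> independent_family (P - {p}) w J"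
proof (rule ccontr)
  assume neg: "\<not> ?thesis"
  have J: "independent_family P w J"
    using independent_family_subset[OF assms(1)] assms(3) by blast
  have "\<exists>c. \<forall>q\<in>P. (\<Sum>j\<in>J. c j * w j q) = (if q = p then w b p else 0)" if p: "p \<in> P" for p
  proof (cases "w b p = 0")
    case True
    then show ?thesis
      by (intro exI[of _ "\<lambda>_. 0"]) simp
  next
    case False
    then obtain c where c: "\<forall>q\<in>P - {p}. (\<Sum>j\<in>J. c j * w j q) = 0" "\<not> (\<forall>j\<in>J. c j = 0)"
      using neg p unfolding independent_family_def by blast
    \<comment> \<open>The value of the relation \<open>c\<close> at \<open>p\<close>, the only
      coordinate in \<open>P\<close> where it can be nonzero; rescaling by \<open>w b p / s\<close>
      turns it into \<open>w b p\<close>.\<close>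
    define s where "s = (\<Sum>j\<in>J. c j * w j p)"
    have "s \<noteq> 0"
    proof
      assume "s = 0"
      have "(\<Sum>j\<in>J. c j * w j q) = 0" if "q \<in> P" for q
        using c(1) \<open>s = 0\<close> that by (cases "q = p") (simp_all add: s_def)
      then show False
        using J[unfolded independent_family_def, THEN spec, of c] c(2) by blast
    qed
    have "(\<Sum>j\<in>J. (w b p / s * c j) * w j q) = w b p / s * (\<Sum>j\<in>J. c j * w j q)" for q
      by (simp add: sum_distrib_left mult.assoc)
    then show ?thesis
      using c(1) \<open>s \<noteq> 0\<close> by (intro exI[of _ "\<lambda>j. w b p / s * c j"]) (simp add: s_def)
  qed
  then have "\<forall>p\<in>P. \<exists>c. \<forall>q\<in>P. (\<Sum>j\<in>J. c j * w j q) = (if q = p then w b p else 0)"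
    by blast
  from bchoice[OF this] obtain c where c: "\<And>p q. p \<in> P \<Longrightarrow> q \<in> P \<Longrightarrow>
      (\<Sum>j\<in>J. c p j * w j q) = (if q = p then w b p else 0)"
    by blast
  \<comment> \<open>Adding the combinations for all \<open>p\<close> expresses \<open>w b\<close>
    through \<open>J\<close>; the coefficient -1 at \<open>b\<close> makes this a relation on
    \<open>insert b J\<close>.\<close>
  let ?d = "\<lambda>j. if j = b then -1 else (\<Sum>p\<in>P. c p j)"
  have "(\<Sum>j\<in>insert b J. ?d j * w j q) = 0" if q: "q \<in> P" for q
  proof -
    have "(\<Sum>j\<in>J. ?d j * w j q) = (\<Sum>j\<in>J. \<Sum>p\<in>P. c p j * w j q)"
      using assms(4) by (intro sum.cong) (auto simp: sum_distrib_right)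
    also have "\<dots> = (\<Sum>p\<in>P. \<Sum>j\<in>J. c p j * w j q)"
      by (rule sum.swap)
    also have "\<dots> = w b q"
      using c q assms(2) by (simp add: sum.delta')
    finally show ?thesis
      using assms(3,4) by simp
  qed
  then have "?d b = 0"
    using assms(1)[unfolded independent_family_def, rule_format, of ?d b] by blast
  then show False by simp
qed

text \<open>A nonzero term in the expansion of a nonzero minor would give such a matching. Here each
  member in turn takes a coordinate whose deletion keeps the remaining family independent, so
  \<open>P\<close> shrinks along with \<open>J\<close>.\<close>

lemma independent_family_matching:
  assumes "finite J" "finite P" "independent_family P w J"
  shows "\<exists>\<pi>. inj_on \<pi> J \<and> \<pi> ` J \<subseteq> P \<and> (\<forall>j\<in>J. w j (\<pi> j) \<noteq> 0)"
  using assms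
proof (induction J arbitrary: P rule: finite_induct)
  case empty
  then show ?case by auto
next
  case (insert b J)
  obtain p where p: "p \<in> P" "w b p \<noteq> 0" "independent_family (P - {p}) w J"
    using independent_family_delete_coordinate[OF insert.prems(2,1) insert.hyps] by blast
  then obtain \<pi> where "inj_on \<pi> J" "\<pi> ` J \<subseteq> P - {p}" "\<forall>j\<in>J. w j (\<pi> j) \<noteq> 0"
    using insert.IH[of "P - {p}"] insert.prems by auto
  then show ?case
    using insert.hyps p by (intro exI[of _ "\<pi>(b := p)"]) (auto simp: inj_on_def)
qed

section \<open>Rank functions of q-matroids, and coordinates\<close>

locale coordinatized_space = finite_field_vector_space scale
  for scale :: "'a::{field,finite} \<Rightarrow> 'b::ab_group_add \<Rightarrow> 'b" (infixr "*s" 75) +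
  fixes b :: "nat \<Rightarrow> 'b" and n :: nat
  assumes inj_b: "inj_on b {1..n}"
    and basis_b: "vector_basis (b ` {1..n}) UNIV"
begin

sublocale fd: finite_dimensional_vector_space scale "b ` {1..n}"
  using basis_b by unfold_locales (auto simp: vector_basis_def)

text \<open>Take an independent \<open>I\<close> in \<open>A\<close> of greatest dimension. No
  single vector of \<open>A\<close> raises its rank, and submodularity extends this to finitely many
  vectors, hence to a basis of \<open>A\<close>.\<close>

lemma q_matroid_rank_attained:
  assumes r: "q_matroid r" and A: "subspace A"
  shows "\<exists>I\<subseteq>A. q_independent r I \<and> r A = dim I"
proof -
  have rank_le: "r T \<le> dim T" if "subspace T" for T
    using r that unfolding q_matroid_def by blast
  have mono: "r S \<le> r T" if "subspace S" "subspace T" "S \<subseteq> T" for S T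
    using r that unfolding q_matroid_def by blast
  have submod: "r (span (S \<union> T)) + r (S \<inter> T) \<le> r S + r T" if "subspace S" "subspace T" for S T
    using r that unfolding q_matroid_def by blast
  let ?P = "\<lambda>I. I \<subseteq> A \<and> q_independent r I"
  have "?P {0}"
    using rank_le[of "{0}"] A subspace_0 by (simp add: q_independent_def)
  moreover have "\<forall>I. ?P I \<longrightarrow> dim I < Suc (dim A)"
    using fd.dim_subset by (auto simp: less_Suc_eq_le)
  ultimately obtain I where I: "I \<subseteq> A" "q_independent r I"
    and max: "\<And>J. J \<subseteq> A \<Longrightarrow> q_independent r J \<Longrightarrow> dim J \<le> dim I"
    using ex_has_greatest_nat[of ?P "{0}" dim "Suc (dim A)"] by auto
  have I_sub: "subspace I" and r_I: "r I = dim I"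
    using I(2) by (simp_all add: q_independent_def)
  have span_I: "span I = I"
    using I_sub by (simp add: span_eq_iff)
  have step: "r (span (insert x I)) \<le> r I" if "x \<in> A" for x
  proof (cases "x \<in> I")
    case True
    then show ?thesis
      by (simp add: insert_absorb span_I)
  next
    case False
    then have d: "dim (span (insert x I)) = Suc (dim I)"
      by (simp add: fd.dim_insert span_I)
    have "span (insert x I) \<subseteq> A"
      using that I(1) A by (intro span_minimal) auto
    then have "\<not> q_independent r (span (insert x I))"
      using max[of "span (insert x I)"] d by auto
    then show ?thesis
      using rank_le[of "span (insert x I)"] d r_I by (simp add: q_independent_def)
  qed
  have grow: "r (span (I \<union> E)) \<le> r I" if "finite E" "E \<subseteq> A" for E
    using that
  proof (induction E rule: finite_induct)
    case empty
    then show ?case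
      by (simp add: span_I)
  next
    case (insert x E)
    \<comment> \<open>Both spans have rank at most \<open>r I\<close> and their intersection
      contains \<open>I\<close>, so submodularity bounds the rank of the join by
      \<open>r I\<close>.\<close>
    let ?S = "span (I \<union> E)" and ?T = "span (insert x I)"
    have "I \<union> insert x E \<subseteq> ?S \<union> ?T"
      using span_superset[of "I \<union> E"] span_superset[of "insert x I"] by auto
    then have "r (span (I \<union> insert x E)) \<le> r (span (?S \<union> ?T))"
      by (intro mono subspace_span span_mono)
    moreover have "r I \<le> r (?S \<inter> ?T)"
    proof (intro mono subspace_inter subspace_span I_sub)
      show "I \<subseteq> ?S \<inter> ?T"
        using span_superset[of "I \<union> E"] span_superset[of "insert x I"] by auto
    qed
    ultimately show ?case
      using submod[of ?S ?T] step[of x] insert by simp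
  qed
  obtain D where D: "D \<subseteq> A" "independent D" "A \<subseteq> span D"
    using maximal_independent_subset[of A] by metis
  have "A \<subseteq> span (I \<union> D)"
    using D(3) span_mono[of D "I \<union> D"] by blast
  then have "r A \<le> r (span (I \<union> D))"
    using A by (intro mono subspace_span)
  also have "\<dots> \<le> r I"
    using D fd.finiteI_independent by (intro grow) auto
  finally have "r A = dim I"
    using mono[OF I_sub A I(1)] r_I by simp
  then show ?thesis
    using I by blast
qed

text \<open>Each rank is attained on an independent subspace of \<open>A\<close>, and these are
  common to the two q-matroids, so monotonicity gives both inequalities.\<close>

lemma q_matroid_rank_unique:
  assumes r: "q_matroid r" "q_matroid r'" and eq: "\<And>T. q_independent r T \<longleftrightarrow> q_independent r' T"
    and A: "subspace A"
  shows "r A = r' A"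
proof -
  have "s A \<le> s' A"
    if s: "q_matroid s" "q_matroid s'" "\<And>T. q_independent s T \<longleftrightarrow> q_independent s' T" for s s'
  proof -
    obtain I where I: "I \<subseteq> A" "q_independent s I" "s A = dim I"
      using q_matroid_rank_attained[OF s(1) A] by blast
    then have "q_independent s' I"
      using s(3) by blast
    then have "subspace I" "s A = s' I"
      using I(3) by (simp_all add: q_independent_def)
    then show ?thesis
      using I(1) A s(2) unfolding q_matroid_def by simp
  qed
  then show ?thesis
    using r eq by (metis order_antisym)
qed

definition coord :: "nat \<Rightarrow> 'b \<Rightarrow> 'a" where
  "coord j v = representation (b ` {1..n}) v (b j)"

lemma basis_facts: "independent (b ` {1..n})" "span (b ` {1..n}) = UNIV"
  using basis_b by (simp_all add: vector_basis_def)

lemma coord_add: "coord j (u + v) = coord j u + coord j v"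
  unfolding coord_def by (subst representation_add) (simp_all add: basis_facts)

lemma coord_scale: "coord j (c *s v) = c * coord j v"
  unfolding coord_def by (subst representation_scale) (simp_all add: basis_facts)

lemma coord_sum: "coord j (\<Sum>i\<in>I. v i) = (\<Sum>i\<in>I. coord j (v i))"
  unfolding coord_def by (subst representation_sum) (simp_all add: basis_facts)

lemma coord_zero: "coord j 0 = 0"
  by (simp add: coord_def representation_zero)

lemma coord_basis: "i \<in> {1..n} \<Longrightarrow> j \<in> {1..n} \<Longrightarrow> coord j (b i) = (if i = j then 1 else 0)"
  unfolding coord_def using inj_b by (auto simp: representation_basis basis_facts inj_on_eq_iff)

lemma coord_combination:
  "j \<in> {1..n} \<Longrightarrow> coord j (\<Sum>i\<in>{1..n}. c i *s b i) = c j"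
  by (simp add: coord_sum coord_scale coord_basis if_distrib cong: if_cong)

lemma sum_coord: "(\<Sum>j\<in>{1..n}. coord j v *s b j) = v"
proof -
  have "(\<Sum>x\<in>b ` {1..n}. representation (b ` {1..n}) v x *s x) = v"
    by (rule sum_representation_eq) (simp_all add: basis_facts)
  then show ?thesis
    using inj_b by (simp add: sum.reindex coord_def)
qed

lemma coord_eq_0_imp_eq_0: "(\<And>j. j \<in> {1..n} \<Longrightarrow> coord j v = 0) \<Longrightarrow> v = 0"
  using sum_coord[of v] by simp

lemma in_span_basis_subset_iff:
  assumes "L \<subseteq> {1..n}"
  shows "v \<in> span (b ` L) \<longleftrightarrow> (\<forall>j\<in>{1..n} - L. coord j v = 0)"
proof
  assume "v \<in> span (b ` L)"
  then show "\<forall>j\<in>{1..n} - L. coord j v = 0"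
  proof (induction rule: span_induct_alt)
    case base
    then show ?case by (simp add: coord_zero)
  next
    case (step c x y)
    then obtain i where i: "i \<in> L" "x = b i"
      by blast
    have "coord j x = 0" if "j \<in> {1..n} - L" for j
      using that i assms coord_basis[of i j] by auto
    then show ?case
      using step by (simp add: coord_add coord_scale)
  qed
next
  assume *: "\<forall>j\<in>{1..n} - L. coord j v = 0"
  have "(\<Sum>j\<in>{1..n}. coord j v *s b j) \<in> span (b ` L)"
  proof (rule span_sum)
    fix j assume "j \<in> {1..n}"
    then show "coord j v *s b j \<in> span (b ` L)"
      using * by (cases "j \<in> L") (simp_all add: span_scale span_base span_zero)
  qed
  then show "v \<in> span (b ` L)"
    by (simp add: sum_coord)
qed

text \<open>Coordinates embed the space into a finite function space. Having finitely many subspaces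
  is what lets one matrix serve all of them.\<close>

lemma finite_vectors: "finite (UNIV :: 'b set)"
proof -
  have "inj (\<lambda>v. restrict (\<lambda>j. coord j v) {1..n})"
  proof (rule injI)
    fix u v assume eq: "restrict (\<lambda>j. coord j u) {1..n} = restrict (\<lambda>j. coord j v) {1..n}"
    have "coord j u = coord j v" if "j \<in> {1..n}" for j
      using fun_cong[OF eq, of j] that by simp
    then have "(\<Sum>j\<in>{1..n}. coord j u *s b j) = (\<Sum>j\<in>{1..n}. coord j v *s b j)"
      by (intro sum.cong) simp_all
    then show "u = v"
      by (simp add: sum_coord)
  qed
  moreover have "range (\<lambda>v. restrict (\<lambda>j. coord j v) {1..n}) \<subseteq> {1..n} \<rightarrow>\<^sub>E (UNIV :: 'a set)"
    by auto
  moreover have "finite ({1..n} \<rightarrow>\<^sub>E (UNIV :: 'a set))"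
    by (intro finite_PiE) auto
  ultimately show ?thesis
    using finite_imageD finite_subset by blast
qed

end

section \<open>Extension of scalars along a field homomorphism\<close>

locale scalar_extension = coordinatized_space scale b n
  for scale :: "'a::{field,finite} \<Rightarrow> 'b::ab_group_add \<Rightarrow> 'b" (infixr "*s" 75)
    and b :: "nat \<Rightarrow> 'b" and n :: nat +
  fixes h :: "'a \<Rightarrow> 'k::field"
  assumes h_add: "h (x + y) = h x + h y"
    and h_mult: "h (x * y) = h x * h y"
    and h_one: "h 1 = 1"
begin

lemma h_zero: "h 0 = 0"
  using h_add[of 0 0] by (metis add_0_right add_left_cancel)

lemma h_eq_0_iff: "h x = 0 \<longleftrightarrow> x = 0"
proof
  assume "h x = 0"
  show "x = 0"
  proof (rule ccontr)
    assume "x \<noteq> 0"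
    then have "h x * h (inverse x) = 1"
      by (simp flip: h_mult add: h_one)
    then show False
      using \<open>h x = 0\<close> by simp
  qed
qed (simp add: h_zero)

text \<open>Through \<open>h\<close> the larger field is a vector space over the scalars; a nonzero
  \<open>c\<close> is independent there, so a linear functional can be prescribed on it.\<close>

lemma exists_scalar_functional:
  assumes "c \<noteq> 0"
  shows "\<exists>\<phi> :: 'k \<Rightarrow> 'a. \<phi> c \<noteq> 0 \<and> (\<forall>x y. \<phi> (x + y) = \<phi> x + \<phi> y) \<and> (\<forall>a x. \<phi> (h a * x) = a * \<phi> x)"
proof -
  interpret K: vector_space "\<lambda>a x. h a * x"
    by unfold_locales (simp_all add: h_add h_mult h_one algebra_simps)
  interpret F: vector_space "(*) :: 'a \<Rightarrow> 'a \<Rightarrow> 'a"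
    by unfold_locales (simp_all add: algebra_simps)
  interpret KF: vector_space_pair "\<lambda>a x. h a * x" "(*) :: 'a \<Rightarrow> 'a \<Rightarrow> 'a" ..
  have "K.independent {c}"
    using assms by simp
  then obtain \<phi> where \<phi>: "Vector_Spaces.linear (\<lambda>a x. h a * x) (*) \<phi>" "\<phi> c = 1"
    using KF.linear_independent_extend[of "{c}" "\<lambda>_. 1"] by blast
  interpret \<phi>: Vector_Spaces.linear "\<lambda>a x. h a * x" "(*)" \<phi>
    by (fact \<phi>(1))
  show ?thesis
    using \<phi>(2) \<phi>.add \<phi>.scale by (intro exI[of _ \<phi>]) simp
qed

text \<open>Applying an \<open>F\<close>-linear functional \<open>K \<rightarrow> F\<close> to the coefficients turns a relation over \<open>K\<close>
  into one over \<open>F\<close>.\<close>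

lemma coefficients_vanish_outside:
  assumes B: "finite B" "independent B" "B' \<subseteq> B" and D: "D \<subseteq> {1..n}"
    and kernel: "\<And>u. u \<in> span B \<Longrightarrow> (\<And>j. j \<in> D \<Longrightarrow> coord j u = 0) \<Longrightarrow> u \<in> span B'"
    and rel: "\<And>j. j \<in> D \<Longrightarrow> (\<Sum>x\<in>B. c x * h (coord j x)) = 0"
    and y: "y \<in> B - B'"
  shows "c y = 0"
proof (rule ccontr)
  assume "c y \<noteq> 0"
  then obtain \<phi> :: "'k \<Rightarrow> 'a" where \<phi>: "\<phi> (c y) \<noteq> 0" "\<And>u v. \<phi> (u + v) = \<phi> u + \<phi> v"
    "\<And>a v. \<phi> (h a * v) = a * \<phi> v"
    using exists_scalar_functional by blast
  have \<phi>0: "\<phi> 0 = 0"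
    using \<phi>(2)[of 0 0] by (metis add_0_right add_left_cancel)
  have \<phi>_sum: "\<phi> (\<Sum>x\<in>A. f x) = (\<Sum>x\<in>A. \<phi> (f x))" for A :: "'b set" and f
    by (induction A rule: infinite_finite_induct) (simp_all add: \<phi>0 \<phi>(2))
  define u where "u = (\<Sum>x\<in>B. \<phi> (c x) *s x)"
  have "coord j u = 0" if "j \<in> D" for j
  proof -
    have "coord j u = (\<Sum>x\<in>B. coord j x * \<phi> (c x))"
      unfolding u_def by (simp add: coord_sum coord_scale mult.commute)
    also have "\<dots> = \<phi> (\<Sum>x\<in>B. h (coord j x) * c x)"
      by (simp only: \<phi>_sum \<phi>(3))
    also have "(\<Sum>x\<in>B. h (coord j x) * c x) = (\<Sum>x\<in>B. c x * h (coord j x))"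
      by (simp add: mult.commute)
    finally show ?thesis
      using rel[OF that] \<phi>0 by simp
  qed
  moreover have "u \<in> span B"
    unfolding u_def by (intro span_sum span_scale span_base)
  ultimately have u: "u \<in> span B'"
    using kernel by blast
  \<comment> \<open>The coefficient of \<open>u\<close> at \<open>y\<close> is 0 because
    \<open>u\<close> lies in the span of \<open>B'\<close>, yet by construction of \<open>u\<close>
    it is \<open>\<phi> (c y)\<close>.\<close>
  have "representation B u y = representation B' u y"
    using representation_extend[OF B(2) u B(3)] by simp
  also have "\<dots> = 0"
    using representation_ne_zero[of B' u y] y by blast
  finally have "representation B u y = 0" .
  moreover have "representation B u y = (\<Sum>x\<in>B. \<phi> (c x) * (if y = x then 1 else 0))"
    unfolding u_def using B(2)
    by (simp add: representation_sum representation_scale representation_basis span_base span_scale)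
  ultimately show False
    using \<phi>(1) y B(1) by (simp add: if_distrib cong: if_cong)
qed

definition semilinear :: "('b \<Rightarrow> nat \<Rightarrow> 'k) \<Rightarrow> bool" where
  "semilinear g \<longleftrightarrow> (\<forall>u v. g (u + v) = g u + g v) \<and> (\<forall>c v. g (c *s v) = vscale (h c) (g v))"

lemma semilinear_image_span:
  assumes "semilinear g"
  shows "g ` span A \<subseteq> kvec.span (g ` A)"
proof
  fix y assume "y \<in> g ` span A"
  then obtain v where v: "v \<in> span A" "y = g v"
    by blast
  have g0: "g 0 = 0"
    using assms[unfolded semilinear_def, THEN conjunct1, rule_format, of 0 0]
    by (metis add_0_right add_left_cancel)
  have "g v \<in> kvec.span (g ` A)"
    using v(1)
  proof (induction rule: span_induct_alt)
    case base
    then show ?case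
      unfolding g0 by (rule kvec.span_zero)
  next
    case (step c x y)
    have "g (c *s x + y) = vscale (h c) (g x) + g y"
      using assms by (simp add: semilinear_def)
    moreover have "vscale (h c) (g x) + g y \<in> kvec.span (g ` A)"
      using step by (intro kvec.span_add kvec.span_scale) (simp_all add: kvec.span_base)
    ultimately show ?case
      by (simp only:)
  qed
  then show "y \<in> kvec.span (g ` A)"
    using v(2) by simp
qed

text \<open>The image of a subspace need only be closed under scalars from the range of
  \<open>h\<close>, but \<open>kvec.dim\<close> depends only on its span over the larger
  field.\<close>

lemma dim_semilinear_image_span:
  assumes "semilinear g"
  shows "kvec.dim (g ` span A) = kvec.dim (g ` A)"
proof (rule kvec.span_eq_dim, rule antisym)
  show "kvec.span (g ` span A) \<subseteq> kvec.span (g ` A)"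
    using semilinear_image_span[OF assms] by (simp add: kvec.span_minimal)
  show "kvec.span (g ` A) \<subseteq> kvec.span (g ` span A)"
    by (intro kvec.span_mono image_mono span_superset)
qed

text \<open>Submodularity is inherited from dimension over the larger field: \<open>g\<close> maps
  an intersection into the intersection of the images, and this inclusion points in the right
  direction.\<close>

lemma q_matroid_semilinear_rank:
  assumes g: "semilinear g"
  shows "q_matroid (\<lambda>U. kvec.dim (g ` U))"
proof -
  let ?C = "g ` b ` {1..n}"
  have C: "finite ?C" "g ` U \<subseteq> kvec.span ?C" for U
    using semilinear_image_span[OF g, of "b ` {1..n}"] by (auto simp: basis_facts)
  have "kvec.dim (g ` A) \<le> dim A" if "subspace A" for A
  proof -
    obtain B where B: "B \<subseteq> A" "independent B" "A \<subseteq> span B" "card B = dim A"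
      using basis_exists[of A] by blast
    have fin: "finite B"
      using B fd.finiteI_independent by blast
    have "g ` A \<subseteq> kvec.span (g ` B)"
      using order_trans[OF image_mono[OF B(3)] semilinear_image_span[OF g]] .
    then have "kvec.dim (g ` A) \<le> card (g ` B)"
      using fin by (intro kvec.dim_le_card) simp_all
    then show ?thesis
      using card_image_le[OF fin, of g] B(4) by simp
  qed
  moreover have "kvec.dim (g ` A) \<le> kvec.dim (g ` B)" if "A \<subseteq> B" for A B
    using image_mono[OF that] by (rule kvec.dim_mono_finite[OF C])
  moreover have "kvec.dim (g ` span (A \<union> B)) + kvec.dim (g ` (A \<inter> B))
      \<le> kvec.dim (g ` A) + kvec.dim (g ` B)" for A B
  proof -
    have "kvec.dim (g ` span (A \<union> B)) = kvec.dim (kvec.span (g ` A \<union> g ` B))"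
      by (simp add: dim_semilinear_image_span[OF g] image_Un)
    moreover have "kvec.dim (g ` (A \<inter> B)) \<le> kvec.dim (g ` A \<inter> g ` B)"
      using C(2)[of A] by (intro kvec.dim_mono_finite[OF C(1)]) auto
    ultimately show ?thesis
      using kvec.dim_submodular[OF C(1) C(2)[of A] C(2)[of B]] by simp
  qed
  ultimately show ?thesis
    unfolding q_matroid_def by blast
qed

text \<open>\<open>dim T\<close> is \<open>card B\<close>, and the images of \<open>B\<close>
  determine the rank; equality holds exactly when these images neither coincide nor become
  dependent.\<close>

lemma semilinear_rank_eq_dim_iff:
  assumes g: "semilinear g" and B: "vector_basis B T"
  shows "kvec.dim (g ` T) = dim T \<longleftrightarrow> inj_on g B \<and> kvec.independent (g ` B)"
proof -
  have B': "independent B" "span B = T" "finite B"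
    using B fd.finiteI_independent by (auto simp: vector_basis_def)
  have dims: "dim T = card B" "kvec.dim (g ` T) = kvec.dim (g ` B)"
    using dim_span_eq_card_independent[OF B'(1)] dim_semilinear_image_span[OF g, of B] B'(2)
    by simp_all
  show ?thesis
  proof
    assume *: "kvec.dim (g ` T) = dim T"
    obtain E where E: "E \<subseteq> g ` B" "kvec.independent E" "g ` B \<subseteq> kvec.span E"
        "card E = kvec.dim (g ` B)"
      using kvec.basis_exists[of "g ` B"] by blast
    have "card B \<le> card (g ` B)"
      using card_mono[OF _ E(1)] B'(3) E(4) * dims by simp
    then have card_eq: "card (g ` B) = card B"
      using card_image_le[OF B'(3), of g] by simp
    have "E = g ` B"
      using E(1,4) B'(3) * dims card_eq by (intro card_subset_eq) simp_all
    then show "inj_on g B \<and> kvec.independent (g ` B)"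
      using eq_card_imp_inj_on[OF B'(3) card_eq] E(2) by simp
  next
    assume *: "inj_on g B \<and> kvec.independent (g ` B)"
    then show "kvec.dim (g ` T) = dim T"
      using dims kvec.dim_eq_card_independent[of "g ` B"] by (simp add: card_image)
  qed
qed

text \<open>\<open>emb v\<close> is \<open>v \<otimes> 1\<close> in coordinates, padded with zeros;
  the extension of \<open>T\<close> to the larger field is the \<open>kvec.span\<close> of its
  image.\<close>

definition emb :: "'b \<Rightarrow> nat \<Rightarrow> 'k" where
  "emb v = (\<lambda>j. if j \<in> {1..n} then h (coord j v) else 0)"

lemma semilinear_emb: "semilinear emb"
  by (auto simp: semilinear_def emb_def vscale_def fun_eq_iff coord_add coord_scale h_add h_mult)

text \<open>The coordinate equations are defined over the small field, so extending scalars adds no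
  solutions beyond the span of the old ones: a basis \<open>B'\<close> of the solutions in
  \<open>T\<close>, extended to a basis of \<open>T\<close>, still spans them.\<close>

lemma dim_extended_coordinate_section:
  assumes T: "subspace T" and D: "D \<subseteq> {1..n}"
  shows "kvec.dim {v \<in> kvec.span (emb ` T). \<forall>j\<in>D. v j = 0} \<le> dim {u \<in> T. \<forall>j\<in>D. coord j u = 0}"
    (is "kvec.dim ?N \<le> dim ?U")
proof -
  obtain B' where B': "B' \<subseteq> ?U" "independent B'" "?U \<subseteq> span B'" "card B' = dim ?U"
    using basis_exists[of ?U] by blast
  then have "B' \<subseteq> T"
    by blast
  then obtain B where B: "B' \<subseteq> B" "B \<subseteq> T" "independent B" "T \<subseteq> span B"
    using maximal_independent_subset_extend[OF _ B'(2), of T] by metis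
  have fin: "finite B" "finite B'"
    using B B' fd.finiteI_independent by blast+
  have span_B: "span B = T"
    using B(2,4) T span_minimal by blast
  have inj: "inj_on emb B"
  proof (rule inj_onI)
    fix x y assume "emb x = emb y"
    have "x - y = 0"
    proof (rule coord_eq_0_imp_eq_0)
      fix j assume j: "j \<in> {1..n}"
      have "h (coord j (x - y)) = 0"
      proof -
        have "coord j x = coord j (x - y) + coord j y"
          by (simp flip: coord_add)
        then have "h (coord j x) = h (coord j (x - y)) + h (coord j y)"
          by (simp add: h_add)
        then show ?thesis
          using fun_cong[OF \<open>emb x = emb y\<close>, of j] j by (simp add: emb_def)
      qed
      then show "coord j (x - y) = 0"
        by (simp add: h_eq_0_iff)
    qed
    then show "x = y" by simp
  qed
  have "?N \<subseteq> kvec.span (emb ` B')"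
  proof
    fix v assume v: "v \<in> ?N"
    have "kvec.span (emb ` T) \<subseteq> kvec.span (emb ` B)"
      using semilinear_image_span[OF semilinear_emb, of B] span_B by (simp add: kvec.span_minimal)
    then have "v \<in> kvec.span (emb ` B)"
      using v by blast
    then obtain a where "v = (\<Sum>w\<in>emb ` B. vscale (a w) w)"
      using kvec.span_finite[of "emb ` B"] fin by blast
    then have v_eq: "v = (\<Sum>x\<in>B. vscale (a (emb x)) (emb x))"
      using inj by (simp add: sum.reindex)
    have zero: "a (emb y) = 0" if "y \<in> B - B'" for y
    proof (rule coefficients_vanish_outside[OF fin(1) B(3,1) D _ _ that])
      show "u \<in> span B'" if "u \<in> span B" "\<And>j. j \<in> D \<Longrightarrow> coord j u = 0" for u
        using that span_B B'(3) by blast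
      show "(\<Sum>x\<in>B. a (emb x) * h (coord j x)) = 0" if j: "j \<in> D" for j
      proof -
        have "v j = (\<Sum>x\<in>B. a (emb x) * h (coord j x))"
          using j D unfolding v_eq by (auto simp: sum_fun_apply vscale_def emb_def)
        then show ?thesis
          using v j by simp
      qed
    qed
    have "v = (\<Sum>x\<in>B'. vscale (a (emb x)) (emb x))"
      unfolding v_eq using zero fin B(1) by (intro sum.mono_neutral_right) simp_all
    then show "v \<in> kvec.span (emb ` B')"
      by (auto intro: kvec.span_sum kvec.span_scale kvec.span_base)
  qed
  then have "kvec.dim ?N \<le> card (emb ` B')"
    using fin by (intro kvec.dim_le_card) simp_all
  then show ?thesis
    using card_image_le[OF fin(2), of emb] B'(4) by simp
qed

section \<open>Transversals and the representing matrix\<close>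

lemma partial_q_transversal_dim_le:
  assumes T: "partial_q_transversal k Xs T" and I: "I \<subseteq> {1..k}"
    and U: "U \<subseteq> T" "\<And>i. i \<in> I \<Longrightarrow> U \<subseteq> Xs i"
  shows "dim U \<le> k - card I"
proof -
  obtain B' where B': "B' \<subseteq> U" "independent B'" "U \<subseteq> span B'" "card B' = dim U"
    using basis_exists[of U] by blast
  then have "B' \<subseteq> T"
    using U(1) by blast
  then obtain B where B: "B' \<subseteq> B" "B \<subseteq> T" "independent B" "T \<subseteq> span B"
    using maximal_independent_subset_extend[OF _ B'(2), of T] by metis
  have "subspace T"
    using T by (simp add: partial_q_transversal_def)
  then have "vector_basis B T"
    using B span_minimal[OF B(2)] by (auto simp: vector_basis_def)
  then obtain \<pi> where \<pi>: "inj_on \<pi> B" "\<pi> ` B \<subseteq> {1..k}" "\<And>x. x \<in> B \<Longrightarrow> x \<notin> Xs (\<pi> x)"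
    using T unfolding partial_q_transversal_def by blast
  \<comment> \<open>A vector of \<open>U\<close> lies in \<open>Xs i\<close> for every
    \<open>i \<in> I\<close>, so \<open>\<pi>\<close> cannot send it into \<open>I\<close>.\<close>
  have "\<pi> ` B' \<subseteq> {1..k} - I"
    using \<pi>(2,3) B(1) B'(1) U(2) by blast
  then have "card (\<pi> ` B') \<le> card ({1..k} - I)"
    by (intro card_mono) simp_all
  moreover have "card (\<pi> ` B') = dim U"
    using card_image[OF inj_on_subset[OF \<pi>(1) B(1)]] B'(4) by simp
  moreover have "card ({1..k} - I) = k - card I"
    using card_Diff_subset[OF finite_subset[OF I] I] by simp
  ultimately show ?thesis by simp
qed

text \<open>The product of \<open>G\<close> with the coordinate vector; the zero padding makes
  equality of functions the same as equality of the \<open>k\<close> entries.\<close>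

definition matrix_map :: "nat \<Rightarrow> (nat \<Rightarrow> nat \<Rightarrow> 'k) \<Rightarrow> 'b \<Rightarrow> nat \<Rightarrow> 'k" where
  "matrix_map k G v = (\<lambda>p. if p \<in> {1..k} then (\<Sum>j\<in>{1..n}. G p j * h (coord j v)) else 0)"

lemma semilinear_matrix_map: "semilinear (matrix_map k G)"
  by (auto simp: semilinear_def matrix_map_def vscale_def fun_eq_iff coord_add coord_scale h_add h_mult
      sum.distrib sum_distrib_left algebra_simps)

lemma exists_matrix_partial_q_transversals:
  assumes inf: "infinite (UNIV :: 'k set)"
    and Xs: "\<forall>i\<in>{1..k}. \<exists>L\<subseteq>{1..n}. Xs i = span (b ` L)"
  shows "\<exists>G. \<forall>T. subspace T \<longrightarrow>
           (partial_q_transversal k Xs T \<longleftrightarrow> kvec.dim (matrix_map k G ` T) = dim T)"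
proof -
  obtain L where L: "\<And>i. i \<in> {1..k} \<Longrightarrow> L i \<subseteq> {1..n}" "\<And>i. i \<in> {1..k} \<Longrightarrow> Xs i = span (b ` L i)"
    using bchoice[OF Xs] by blast
  define S where "S i = {1..n} - L i" for i
  have in_Xs: "v \<in> Xs i \<longleftrightarrow> (\<forall>j\<in>S i. coord j v = 0)" if "i \<in> {1..k}" for i v
    using in_span_basis_subset_iff[OF L(1)[OF that]] L(2)[OF that] by (simp add: S_def)
  \<comment> \<open>The extensions of all partial transversals at once, so that the rows found below
    do not depend on \<open>T\<close>.\<close>
  define \<N> where "\<N> = (\<lambda>T. kvec.span (emb ` T)) ` {T. partial_q_transversal k Xs T}"
  have "\<exists>x. \<forall>N\<in>\<N>. \<forall>v\<in>N. (\<forall>p\<in>{1..k}. (\<Sum>j\<in>S p. x p j * v j) = 0) \<longrightarrow> v = 0"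
  proof (rule generic_rows_trivial_kernel[OF inf])
    show "finite (S p)" for p
      by (simp add: S_def)
    have "finite (UNIV :: 'b set set)"
      using finite_vectors by (simp add: Finite_Set.finite_set)
    then show "finite \<N>"
      unfolding \<N>_def by (intro finite_imageI) (rule finite_subset[OF subset_UNIV])
    show "kvec.subspace N" if "N \<in> \<N>" for N
      using that by (auto simp: \<N>_def)
    show "\<exists>C. finite C \<and> N \<subseteq> kvec.span C" if "N \<in> \<N>" for N
    proof -
      from that obtain T where "N = kvec.span (emb ` T)"
        unfolding \<N>_def by blast
      moreover have "finite T"
        using finite_subset[OF subset_UNIV finite_vectors] .
      ultimately show ?thesis
        by (intro exI[of _ "emb ` T"]) simp
    qed
    show "kvec.dim {v \<in> N. \<forall>p\<in>I. \<forall>j\<in>S p. v j = 0} \<le> k - card I"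
      if N: "N \<in> \<N>" and I: "I \<subseteq> {1..k}" for N I
    proof -
      obtain T where T: "N = kvec.span (emb ` T)" "partial_q_transversal k Xs T"
        using N unfolding \<N>_def by blast
      \<comment> \<open>Lying in every \<open>Xs p\<close> with \<open>p \<in> I\<close> means that
        all coordinates in the union \<open>?D\<close> vanish.\<close>
      let ?D = "\<Union>p\<in>I. S p" and ?U = "{u \<in> T. \<forall>j\<in>\<Union>p\<in>I. S p. coord j u = 0}"
      have "{v \<in> N. \<forall>p\<in>I. \<forall>j\<in>S p. v j = 0} = {v \<in> kvec.span (emb ` T). \<forall>j\<in>?D. v j = 0}"
        using T(1) by auto
      moreover have "kvec.dim {v \<in> kvec.span (emb ` T). \<forall>j\<in>?D. v j = 0} \<le> dim ?U"
        using T(2) by (intro dim_extended_coordinate_section) (auto simp: partial_q_transversal_def S_def)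
      moreover have "dim ?U \<le> k - card I"
        using I in_Xs by (intro partial_q_transversal_dim_le[OF T(2)]) auto
      ultimately show ?thesis by simp
    qed
  qed
  then obtain x where x: "\<And>T v. partial_q_transversal k Xs T \<Longrightarrow> v \<in> kvec.span (emb ` T) \<Longrightarrow>
      (\<And>p. p \<in> {1..k} \<Longrightarrow> (\<Sum>j\<in>S p. x p j * v j) = 0) \<Longrightarrow> v = 0"
    unfolding \<N>_def by blast
  \<comment> \<open>Row \<open>p\<close> is supported on \<open>S p\<close>, so for
    \<open>p \<in> {1..k}\<close> it vanishes on \<open>Xs p\<close>.\<close>
  define G where "G p j = (if j \<in> S p then x p j else 0)" for p j
  have G_sum: "(\<Sum>j\<in>{1..n}. G p j * w j) = (\<Sum>j\<in>S p. x p j * w j)" for p w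
    by (rule sum.mono_neutral_cong_right) (auto simp: G_def S_def)
  let ?g = "matrix_map k G"
  \<comment> \<open>The rank condition can be read off any basis: one basis suffices to prove it,
    and assuming it yields a matching for each basis.\<close>
  have indep_iff: "kvec.dim (?g ` T) = dim T \<longleftrightarrow> independent_family {1..k} ?g B"
    if B: "vector_basis B T" for B T
  proof -
    have "finite B"
      using B fd.finiteI_independent by (simp add: vector_basis_def)
    then have "independent_family {1..k} ?g B \<longleftrightarrow> inj_on ?g B \<and> kvec.independent (?g ` B)"
      by (rule independent_family_iff_independent) (auto simp: matrix_map_def)
    then show ?thesis
      using semilinear_rank_eq_dim_iff[OF semilinear_matrix_map B] by simp
  qed
  have "partial_q_transversal k Xs T \<longleftrightarrow> kvec.dim (?g ` T) = dim T" if T: "subspace T" for T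
  proof
    assume pq: "partial_q_transversal k Xs T"
    obtain B where B: "vector_basis B T"
    proof -
      obtain B where B: "B \<subseteq> T" "independent B" "T \<subseteq> span B"
        using maximal_independent_subset[of T] by metis
      then have "vector_basis B T"
        using T span_minimal[OF B(1) T] by (auto simp: vector_basis_def)
      then show thesis by (rule that)
    qed
    then have B': "B \<subseteq> T" "independent B" "finite B"
      using fd.finiteI_independent by (auto simp: vector_basis_def)
    have "independent_family {1..k} ?g B"
      unfolding independent_family_def
    proof (intro allI impI ballI)
      fix c y assume c: "\<forall>p\<in>{1..k}. (\<Sum>z\<in>B. c z * ?g z p) = 0" and y: "y \<in> B"
      \<comment> \<open>A relation among the images of \<open>B\<close> becomes a vector of the
        extended space killed by all rows, hence 0.\<close>
      define v where "v = (\<Sum>z\<in>B. vscale (c z) (emb z))"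
      have v_apply: "v j = (\<Sum>z\<in>B. c z * h (coord j z))" if "j \<in> {1..n}" for j
        using that by (simp add: v_def sum_fun_apply vscale_def emb_def)
      have "v = 0"
      proof (rule x[OF pq])
        show "v \<in> kvec.span (emb ` T)"
          unfolding v_def using B'(1) by (intro kvec.span_sum kvec.span_scale kvec.span_base) blast
        show "(\<Sum>j\<in>S p. x p j * v j) = 0" if p: "p \<in> {1..k}" for p
        proof -
          have "(\<Sum>j\<in>S p. x p j * v j) = (\<Sum>j\<in>{1..n}. G p j * (\<Sum>z\<in>B. c z * h (coord j z)))"
            unfolding G_sum[symmetric] using v_apply by (intro sum.cong) simp_all
          also have "\<dots> = (\<Sum>z\<in>B. c z * (\<Sum>j\<in>{1..n}. G p j * h (coord j z)))"
            unfolding sum_distrib_left by (subst sum.swap) (simp add: mult_ac)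
          also have "\<dots> = (\<Sum>z\<in>B. c z * ?g z p)"
            using p by (simp add: matrix_map_def)
          finally show ?thesis
            using c p by simp
        qed
      qed
      show "c y = 0"
      \<comment> \<open>Only 0 has all coordinates zero, so the exceptional set \<open>{}\<close> is
        allowed and every coefficient vanishes.\<close>
      proof (rule coefficients_vanish_outside[OF B'(3,2), of "{}" "{1..n}"])
        show "u \<in> span {}" if "\<And>j. j \<in> {1..n} \<Longrightarrow> coord j u = 0" for u
          using coord_eq_0_imp_eq_0[OF that] by simp
        show "(\<Sum>x\<in>B. c x * h (coord j x)) = 0" if "j \<in> {1..n}" for j
          using v_apply[OF that] \<open>v = 0\<close> by simp
      qed (use y in simp_all)
    qed
    then show "kvec.dim (?g ` T) = dim T"
      using indep_iff[OF B] by simp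
  next
    assume d: "kvec.dim (?g ` T) = dim T"
    have "\<exists>\<pi>. inj_on \<pi> B \<and> \<pi> ` B \<subseteq> {1..k} \<and> (\<forall>z\<in>B. z \<notin> Xs (\<pi> z))" if B: "vector_basis B T" for B
    proof -
      have "finite B"
        using B fd.finiteI_independent by (simp add: vector_basis_def)
      then obtain \<pi> where \<pi>: "inj_on \<pi> B" "\<pi> ` B \<subseteq> {1..k}" "\<forall>z\<in>B. ?g z (\<pi> z) \<noteq> 0"
        using independent_family_matching[of B "{1..k}" ?g] indep_iff[OF B] d by auto
      have "z \<notin> Xs (\<pi> z)" if z: "z \<in> B" for z
      proof
        assume "z \<in> Xs (\<pi> z)"
        moreover have p: "\<pi> z \<in> {1..k}"
          using \<pi>(2) z by blast
        ultimately have "\<forall>j\<in>S (\<pi> z). coord j z = 0"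
          using in_Xs by blast
        then have "?g z (\<pi> z) = 0"
          using p by (simp add: matrix_map_def G_sum h_zero)
        then show False
          using \<pi>(3) z by blast
      qed
      then show ?thesis
        using \<pi> by blast
    qed
    then show "partial_q_transversal k Xs T"
      using T unfolding partial_q_transversal_def by blast
  qed
  then show ?thesis by blast
qed

end

section \<open>Transport of a field along an injection, as \<open>q_representable\<close> asks for a
  carrier of naturals\<close>

definition ring_copy :: "('k::field \<Rightarrow> 'c) \<Rightarrow> 'c ring" where
  "ring_copy f = \<lparr> carrier = range f,
     monoid.mult = (\<lambda>x y. f (the_inv f x * the_inv f y)), one = f 1,
     ring.zero = f 0, add = (\<lambda>x y. f (the_inv f x + the_inv f y)) \<rparr>"

lemma ring_copy_simps:
  assumes "inj f"
  shows "carrier (ring_copy f) = range f"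
    and "f x \<otimes>\<^bsub>ring_copy f\<^esub> f y = f (x * y)"
    and "f x \<oplus>\<^bsub>ring_copy f\<^esub> f y = f (x + y)"
    and "\<one>\<^bsub>ring_copy f\<^esub> = f 1"
    and "\<zero>\<^bsub>ring_copy f\<^esub> = f 0"
  using assms by (simp_all add: ring_copy_def the_inv_f_f)

lemma field_ring_copy:
  assumes "inj f"
  shows "field (ring_copy f)"
proof -
  have "f \<in> ring_iso ring_of_type_algebra (ring_copy f)"
    using assms
    by (intro ring_iso_memI)
      (simp_all add: ring_copy_simps ring_of_type_algebra_def bij_betw_def)
  from field.ring_iso_imp_img_field[OF field_from_type_algebra this]
  show ?thesis
    by (simp add: ring_of_type_algebra_def ring_copy_def)
qed

lemma finsum_ring_copy:
  assumes f: "inj f" and "finite J"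
  shows "(\<Oplus>\<^bsub>ring_copy f\<^esub> j\<in>J. f (a j)) = f (\<Sum>j\<in>J. a j)"
proof -
  interpret field "ring_copy f"
    using f by (rule field_ring_copy)
  show ?thesis
    using assms(2)
    by (induction J rule: finite_induct) (simp_all add: ring_copy_simps[OF f])
qed

text \<open>Coefficients in the carrier correspond to field elements through \<open>f\<close>, so
  relations translate both ways. The indices are transposed: \<open>w j\<close> is column
  \<open>j\<close> of \<open>M\<close>.\<close>

lemma columns_independent_ring_copy:
  assumes f: "inj f" and J: "finite J" and M: "\<And>s j. s \<in> {1..l} \<Longrightarrow> M s j = f (w j s)"
  shows "columns_independent (ring_copy f) l M J \<longleftrightarrow> independent_family {1..l} w J"
proof -
  interpret field "ring_copy f"
    using f by (rule field_ring_copy)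
  have sum_eq: "(\<Oplus>\<^bsub>ring_copy f\<^esub> j\<in>J. M s j \<otimes>\<^bsub>ring_copy f\<^esub> c j) = f (\<Sum>j\<in>J. d j * w j s)"
    if "s \<in> {1..l}" "\<And>j. j \<in> J \<Longrightarrow> c j = f (d j)" for s c d
  proof -
    have "(\<Oplus>\<^bsub>ring_copy f\<^esub> j\<in>J. M s j \<otimes>\<^bsub>ring_copy f\<^esub> c j) = (\<Oplus>\<^bsub>ring_copy f\<^esub> j\<in>J. f (d j * w j s))"
      using that M by (intro finsum_cong') (auto simp: ring_copy_simps[OF f] mult.commute)
    then show ?thesis
      by (simp add: finsum_ring_copy[OF f J])
  qed
  show ?thesis
  proof
    assume L: "columns_independent (ring_copy f) l M J"
    show "independent_family {1..l} w J"
      unfolding independent_family_def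
    proof (intro allI impI)
      fix d assume d: "\<forall>p\<in>{1..l}. (\<Sum>j\<in>J. d j * w j p) = 0"
      have "\<forall>j\<in>J. f (d j) = \<zero>\<^bsub>ring_copy f\<^esub>"
        using L[unfolded columns_independent_def, rule_format, of "\<lambda>j. f (d j)"] d
          sum_eq[of _ "\<lambda>j. f (d j)" d]
        by (simp add: ring_copy_simps[OF f])
      then show "\<forall>j\<in>J. d j = 0"
        using f by (simp add: ring_copy_simps[OF f] inj_eq)
    qed
  next
    assume R: "independent_family {1..l} w J"
    show "columns_independent (ring_copy f) l M J"
      unfolding columns_independent_def
    proof (intro ballI impI)
      fix c j
      assume c: "c \<in> J \<rightarrow> carrier (ring_copy f)" and j: "j \<in> J"
        and zero: "\<forall>i\<in>{1..l}. (\<Oplus>\<^bsub>ring_copy f\<^esub> j\<in>J. M i j \<otimes>\<^bsub>ring_copy f\<^esub> c j) = \<zero>\<^bsub>ring_copy f\<^esub>"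
      define d where "d = the_inv f \<circ> c"
      have cd: "c j = f (d j)" if "j \<in> J" for j
      proof -
        have "c j \<in> range f"
          using c that ring_copy_simps(1)[OF f] by blast
        then show ?thesis
          using f_the_inv_into_f[OF f] by (simp add: d_def)
      qed
      have "\<forall>p\<in>{1..l}. (\<Sum>j\<in>J. d j * w j p) = 0"
        using zero sum_eq[of _ c d] cd f by (simp add: ring_copy_simps[OF f] inj_eq)
      then have "d j = 0"
        using R j unfolding independent_family_def by blast
      then show "c j = \<zero>\<^bsub>ring_copy f\<^esub>"
        using cd[OF j] by (simp add: ring_copy_simps[OF f])
    qed
  qed
qed

text \<open>Both sides are maxima over the same sets of column indices; as \<open>w j\<close> is
  zero outside the row range, columns can be treated as vectors of functions.\<close>

lemma matrix_rank_ring_copy: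
  assumes f: "inj f" and M: "\<And>s j. s \<in> {1..l} \<Longrightarrow> M s j = f (w j s)"
    and w: "\<And>j s. s \<notin> {1..l} \<Longrightarrow> w j s = 0"
  shows "matrix_rank (ring_copy f) l m M = kvec.dim (w ` {1..m})"
proof -
  have "columns_independent (ring_copy f) l M J \<longleftrightarrow> inj_on w J \<and> kvec.independent (w ` J)"
    if "J \<subseteq> {1..m}" for J
  proof -
    have "finite J"
      using that finite_subset by blast
    then show ?thesis
      using columns_independent_ring_copy[of f J l M w] f M
        independent_family_iff_independent[of J "{1..l}" w] w
      by blast
  qed
  then show ?thesis
    unfolding matrix_rank_def by (simp add: kvec.dim_image_eq_Max_card cong: conj_cong)
qed

section \<open>Representability over a countable infinite extension field\<close>

context scalar_extension
begin

text \<open>Column \<open>i\<close> of the product is \<open>G\<close> applied to row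
  \<open>i\<close> of \<open>Y\<close>, and over the larger field these columns span the same space
  as the image of the row space.\<close>

lemma q_representable_matrix_rank:
  assumes e: "inj (e :: 'k \<Rightarrow> nat)"
    and r: "\<And>U. subspace U \<Longrightarrow> r U = kvec.dim (matrix_map k G ` U)"
  shows "q_representable n b r"
proof -
  let ?K = "ring_copy e"
  have "r U = matrix_rank ?K k m (\<lambda>s i. \<Oplus>\<^bsub>?K\<^esub> j\<in>{1..n}. e (G s j) \<otimes>\<^bsub>?K\<^esub> e (h (Y i j)))"
    if U: "subspace U" "U = row_space n b m Y" for U m Y
  proof -
    define y where "y i = (\<Sum>j\<in>{1..n}. Y i j *s b j)" for i
    have "r U = kvec.dim (matrix_map k G ` span (y ` {1..m}))"
      using r[OF U(1)] U(2) by (simp add: row_space_def y_def)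
    also have "\<dots> = kvec.dim ((\<lambda>i. matrix_map k G (y i)) ` {1..m})"
      by (simp add: dim_semilinear_image_span[OF semilinear_matrix_map] image_image)
    also have "\<dots> = matrix_rank ?K k m
        (\<lambda>s i. \<Oplus>\<^bsub>?K\<^esub> j\<in>{1..n}. e (G s j) \<otimes>\<^bsub>?K\<^esub> e (h (Y i j)))"
    proof (rule matrix_rank_ring_copy[OF e, symmetric])
      fix s i assume s: "s \<in> {1..k}"
      have "(\<Sum>j\<in>{1..n}. G s j * h (Y i j)) = (\<Sum>j\<in>{1..n}. G s j * h (coord j (y i)))"
        by (intro sum.cong) (simp_all add: y_def coord_combination)
      then show "(\<Oplus>\<^bsub>?K\<^esub> j\<in>{1..n}. e (G s j) \<otimes>\<^bsub>?K\<^esub> e (h (Y i j))) = e (matrix_map k G (y i) s)"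
        using s by (simp add: ring_copy_simps[OF e] finsum_ring_copy[OF e] matrix_map_def)
    qed (auto simp: matrix_map_def)
    finally show ?thesis .
  qed
  moreover have "e \<circ> h \<in> ring_hom (ring_of_type_algebra :: 'a ring) ?K"
    by (intro ring_hom_memI)
      (simp_all add: ring_of_type_algebra_def ring_copy_simps[OF e] h_add h_mult h_one)
  moreover have "e (G s j) \<in> carrier ?K" for s j
    by (simp add: ring_copy_simps[OF e])
  ultimately show ?thesis
    unfolding q_representable_def using field_ring_copy[OF e]
    by (intro exI[of _ ?K] exI[of _ "e \<circ> h"] exI[of _ k] exI[of _ "\<lambda>s j. e (G s j)"]) auto
qed

text \<open>The rank function of the matrix proves existence, and by uniqueness every other
  candidate agrees with it on subspaces.\<close>

lemma q_transversal_matroid_representable: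
  assumes "infinite (UNIV :: 'k set)" and e: "inj (e :: 'k \<Rightarrow> nat)"
    and "\<forall>i\<in>{1..k}. \<exists>L\<subseteq>{1..n}. Xs i = span (b ` L)"
  shows "(\<exists>r. is_q_transversal_matroid k Xs r) \<and>
         (\<forall>r. is_q_transversal_matroid k Xs r \<longrightarrow> q_representable n b r)"
proof -
  obtain G where G: "\<And>T. subspace T \<Longrightarrow>
      partial_q_transversal k Xs T \<longleftrightarrow> kvec.dim (matrix_map k G ` T) = dim T"
    using exists_matrix_partial_q_transversals[OF assms(1,3)] by blast
  let ?r = "\<lambda>U. kvec.dim (matrix_map k G ` U)"
  have "q_independent ?r T \<longleftrightarrow> partial_q_transversal k Xs T" for T
    using G[of T] by (auto simp: q_independent_def partial_q_transversal_def)
  then have r: "is_q_transversal_matroid k Xs ?r"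
    using q_matroid_semilinear_rank[OF semilinear_matrix_map]
    by (simp add: is_q_transversal_matroid_def)
  moreover have "q_representable n b r" if "is_q_transversal_matroid k Xs r" for r
  proof (rule q_representable_matrix_rank[OF e])
    show "r U = kvec.dim (matrix_map k G ` U)" if U: "subspace U" for U
      using q_matroid_rank_unique[of r ?r, OF _ _ _ U] r \<open>is_q_transversal_matroid k Xs r\<close>
      by (simp add: is_q_transversal_matroid_def)
  qed
  ultimately show ?thesis by blast
qed

end

section \<open>The field of rational functions over a finite field\<close>

lemma countable_rational_functions: "countable (UNIV :: 'a::{field,finite} poly fract set)"
proof -
  have "countable (lists (UNIV :: 'a set))"
    by (intro countable_lists countable_finite) simp
  then have "countable (range (coeffs :: 'a poly \<Rightarrow> 'a list))"
    by (rule countable_subset[rotated]) simp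
  then have poly: "countable (UNIV :: 'a poly set)"
    by (rule countable_image_inj_on) (simp add: inj_on_def coeffs_eq_iff)
  have "(UNIV :: 'a poly fract set) \<subseteq> (\<lambda>(p, q). Fraction_Field.Fract p q) ` (UNIV \<times> UNIV)"
  proof
    fix x :: "'a poly fract"
    show "x \<in> (\<lambda>(p, q). Fraction_Field.Fract p q) ` (UNIV \<times> UNIV)"
      by (cases x) auto
  qed
  then show ?thesis
    using poly by (meson countable_SIGMA countable_image countable_subset)
qed

lemma infinite_rational_functions: "infinite (UNIV :: 'a::field poly fract set)"
proof -
  have "inj (\<lambda>m. Fraction_Field.Fract (monom (1::'a) m) 1)"
    by (simp add: inj_on_def eq_fract monom_eq_iff')
  then show ?thesis
    using finite_subset[OF subset_UNIV] range_inj_infinite by blast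
qed

theorem theorem26:
  fixes scale :: "'a::{field,finite} \<Rightarrow> 'v::ab_group_add \<Rightarrow> 'v"
    and b :: "nat \<Rightarrow> 'v" and n k :: nat
    and Xs :: "nat \<Rightarrow> 'v set"
  assumes "finite_field_vector_space scale"
    and "inj_on b {1..n}"
    and "finite_field_vector_space.vector_basis scale (b ` {1..n}) UNIV"
    and "\<forall>i\<in>{1..k}. \<exists>L\<subseteq>{1..n}. Xs i = Modules.module.span scale (b ` L)"
  shows "(\<exists>r. finite_field_vector_space.is_q_transversal_matroid scale k Xs r) \<and>
         (\<forall>r. finite_field_vector_space.is_q_transversal_matroid scale k Xs r
              \<longrightarrow> finite_field_vector_space.q_representable scale n b r)"
proof -
  interpret finite_field_vector_space scale
    by (fact assms(1))
  \<comment> \<open>The scalars embed as constants into the rational functions, which are infinite,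
    as generic rows require, and countable, so that they can be copied into the naturals.\<close>
  interpret scalar_extension scale b n "\<lambda>a. Fraction_Field.Fract [:a:] 1"
    using assms(2,3) by unfold_locales (simp_all add: One_fract_def one_pCons mult.commute)
  obtain e :: "'a poly fract \<Rightarrow> nat" where "inj e"
    using countable_rational_functions by (auto simp: countable_def)
  then show ?thesis
    using q_transversal_matroid_representable[OF infinite_rational_functions _ assms(4)] by blast
qed

end
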